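(* Let $R$ be a commutative ring with identity containing $\mathbb{Q}$, let $N\ge 2$, let $p\in R[X_1,\ldots,X_N]$, and write $Q = X_1^2+\cdots+X_N^2$. (i) If, for some $c\in R$, the polynomials $M_{jk}p$ for all distinct $j,k\in\{1,\ldots,N\}$ are divisible by $Q-c$, then there is $c'\in R$ such that $p-c'$ is divisible by $Q-c$. (ii) If $p$ is nonzero of degree $d$ and, for some integer $m\ge d/2$, there are $c_1,\ldots,c_m\in R$ whose pairwise differences $c_i-c_{j}$ ($i\ne j$) are not zero divisors, such that each $M_{jk}p$ (for all distinct $j,k\in\{1,\ldots,N\}$) is divisible by $Q-c_i$ for every $i=1,\ldots,m$, then $p$ is a polynomial in $Q$ with coefficients in $R$. (iii) If $p$ is nonzero and homogeneous of degree $d$ and there is $c\in R$ that is not a zero divisor such that $M_{jk}p$ is divisible by $Q-c$ for all distinct $j,k\in\{1,\ldots,N\}$, then $d$ is even and $p = aQ^{d/2}$ for some $a\in R$.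
   Context: For distinct $j,k$, $M_{jk}=X_j\partial_k-X_k\partial_j$ acting on $R[X_1,\ldots,X_N]$, where $\partial_j=\partial/\partial X_j$. Divisibility is in the ring $R[X_1,\ldots,X_N]$; degree is total degree. An element $a\in R$ is "not a zero divisor" if $ab=0$ with $b\in R$ implies $b=0$. *)

theory Defs
  imports Complex_Main "HOL-Library.Poly_Mapping" "HOL-Library.Cardinality"
    "HOL-Computational_Algebra.Polynomial"
begin

text \<open>
  Polynomials over \<open>'a\<close> in variables indexed by the finite type \<open>'n\<close>; the number of variables
  is \<open>CARD('n)\<close>. A polynomial is a finitely supported map from exponent vectors to
  coefficients, and ring operations and divisibility are those of the library for the type
  \<open>('n, 'a) mpol\<close>.
\<close>

type_synonym ('n, 'a) mpol = "('n \<Rightarrow>\<^sub>0 nat) \<Rightarrow>\<^sub>0 'a"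

definition Const :: "'a::comm_ring_1 \<Rightarrow> ('n::finite, 'a) mpol" where
  "Const a = Poly_Mapping.single 0 a"

definition Var :: "'n::finite \<Rightarrow> ('n, 'a::comm_ring_1) mpol" where
  "Var i = Poly_Mapping.single (Poly_Mapping.single i 1) 1"

definition mon_degree :: "('n::finite \<Rightarrow>\<^sub>0 nat) \<Rightarrow> nat" where
  "mon_degree u = (\<Sum>i\<in>UNIV. Poly_Mapping.lookup u i)"

text \<open>The zero polynomial gets degree 0 here.\<close>

definition total_degree :: "('n::finite, 'a::comm_ring_1) mpol \<Rightarrow> nat" where
  "total_degree p = Max (insert 0 (mon_degree ` Poly_Mapping.keys p))"

definition homogeneous :: "nat \<Rightarrow> ('n::finite, 'a::comm_ring_1) mpol \<Rightarrow> bool" where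
  "homogeneous d p \<longleftrightarrow> (\<forall>u \<in> Poly_Mapping.keys p. mon_degree u = d)"

text \<open>
  The monomial \<open>a * X^u\<close> is sent to \<open>u\<^sub>j * a * X^(u - e\<^sub>j)\<close>. The truncated subtraction in the
  exponent is harmless: if \<open>u\<^sub>j = 0\<close>, then the coefficient is zero.
\<close>

definition partial :: "'n::finite \<Rightarrow> ('n, 'a::comm_ring_1) mpol \<Rightarrow> ('n, 'a) mpol" where
  "partial j p = (\<Sum>u\<in>Poly_Mapping.keys p.
     Poly_Mapping.single (u - Poly_Mapping.single j 1)
       (of_nat (Poly_Mapping.lookup u j) * Poly_Mapping.lookup p u))"

definition M :: "'n::finite \<Rightarrow> 'n \<Rightarrow> ('n, 'a::comm_ring_1) mpol \<Rightarrow> ('n, 'a) mpol" where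
  "M j k p = Var j * partial k p - Var k * partial j p"

definition Q :: "('n::finite, 'a::comm_ring_1) mpol" where
  "Q = (\<Sum>i\<in>UNIV. Var i ^ 2)"

definition polynomial_in :: "('n::finite, 'a::comm_ring_1) mpol \<Rightarrow> ('n, 'a) mpol \<Rightarrow> bool" where
  "polynomial_in q p \<longleftrightarrow> (\<exists>f :: 'a poly. p = poly (map_poly Const f) q)"

definition not_zero_divisor :: "'a::comm_ring_1 \<Rightarrow> bool" where
  "not_zero_divisor a \<longleftrightarrow> (\<forall>b. a * b = 0 \<longrightarrow> b = 0)"

definition rat_embedding :: "(rat \<Rightarrow> 'a::comm_ring_1) \<Rightarrow> bool" where
  "rat_embedding h \<longleftrightarrow> inj h \<and> h 1 = 1 \<and>
     (\<forall>x y. h (x + y) = h x + h y) \<and> (\<forall>x y. h (x * y) = h x * h y)"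

end

theory Submission
  imports Defs
begin

text \<open>
  Fix a variable \<open>X\<^sub>i\<close>. Modulo \<open>Q - c\<close> every polynomial is uniquely of the form \<open>a + X\<^sub>i b\<close> with
  \<open>a, b\<close> free of \<open>X\<^sub>i\<close>. Since \<open>M\<^sub>i\<^sub>k\<close> kills \<open>Q\<close>, it acts on these normal forms: with
  \<open>r = Q - X\<^sub>i\<^sup>2\<close>, it sends \<open>a + X\<^sub>i b\<close> to \<open>((c - r) \<partial>\<^sub>k b - X\<^sub>k b) + X\<^sub>i \<partial>\<^sub>k a\<close>. If this vanishes for all
  \<open>k\<close>, then \<open>a\<close> is constant, and comparing leading coefficients \<open>l\<close> with respect to \<open>X\<^sub>k\<close>, say in
  degree \<open>e\<close>, gives \<open>- e l = l\<close>, so \<open>b = 0\<close>. This is (i).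

  For (ii), write \<open>p = c' + (Q - c\<^sub>m) g\<close> by (i); the degree of \<open>g\<close> is smaller by 2, and \<open>Q - c\<^sub>m\<close>,
  congruent to \<open>c\<^sub>l - c\<^sub>m\<close>, cancels modulo \<open>Q - c\<^sub>l\<close>, so induction on \<open>m\<close> applies to \<open>g\<close>.

  For (iii), a nonzero multiple of \<open>Q - c\<close> has terms of two different degrees, so the homogeneous
  \<open>M\<^sub>j\<^sub>k p\<close> vanish and (ii) applies with \<open>c\<^sub>l = l\<close>.
\<close>

section \<open>Coefficients of products\<close>

lemma poly_mapping_induct [case_names single add]:
  fixes p :: "'k \<Rightarrow>\<^sub>0 'a::comm_monoid_add"
  assumes single: "\<And>k a. P (Poly_Mapping.single k a)"
    and add: "\<And>p q. P p \<Longrightarrow> P q \<Longrightarrow> P (p + q)"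
  shows "P p"
proof (induction p rule: update_induct)
  case const
  show ?case using single[of undefined 0] by simp
next
  case (update f a b)
  have "Poly_Mapping.update a b f = Poly_Mapping.single a b + f"
    using update(1)
    by (intro poly_mapping_eqI) (auto simp: lookup_update lookup_add lookup_single when_def in_keys_iff)
  then show ?case using update single add by metis
qed

lemma lookup_monom_times:
  fixes p :: "('n \<Rightarrow>\<^sub>0 nat) \<Rightarrow>\<^sub>0 'a::comm_ring_1"
  shows "Poly_Mapping.lookup (Poly_Mapping.single v a * p) (v + u) = a * Poly_Mapping.lookup p u"
proof (induction p rule: poly_mapping_induct)
  case (single k b)
  then show ?case by (simp add: mult_single lookup_single when_def)
next
  case (add f g)
  then show ?case by (simp add: distrib_left lookup_add)
qed

lemma lookup_monom_times_0:
  fixes p :: "('n \<Rightarrow>\<^sub>0 nat) \<Rightarrow>\<^sub>0 'a::comm_ring_1"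
  assumes "\<And>w. u \<noteq> v + w"
  shows "Poly_Mapping.lookup (Poly_Mapping.single v a * p) u = 0"
  using assms
proof (induction p rule: poly_mapping_induct)
  case (single k b)
  then show ?case by (auto simp add: mult_single lookup_single when_def)
next
  case (add f g)
  then show ?case by (simp add: distrib_left lookup_add)
qed

lemma add_diff_single:
  assumes "n \<le> Poly_Mapping.lookup u i"
  shows "u = Poly_Mapping.single i n + (u - Poly_Mapping.single i (n::nat))"
  using assms by (intro poly_mapping_eqI) (auto simp: lookup_add lookup_minus lookup_single when_def)

lemma lookup_single_times:
  fixes p :: "('n \<Rightarrow>\<^sub>0 nat) \<Rightarrow>\<^sub>0 'a::comm_ring_1"
  shows "Poly_Mapping.lookup (Poly_Mapping.single (Poly_Mapping.single i n) 1 * p) u =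
    (if Poly_Mapping.lookup u i < n then 0 else Poly_Mapping.lookup p (u - Poly_Mapping.single i n))"
proof (cases "Poly_Mapping.lookup u i < n")
  case True
  then show ?thesis
    by (auto intro!: lookup_monom_times_0 simp: lookup_add)
next
  case False
  then show ?thesis
    using lookup_monom_times[of "Poly_Mapping.single i n" 1 p "u - Poly_Mapping.single i n"]
      add_diff_single[of n u i] by simp
qed

lemma lookup_Var_times:
  "Poly_Mapping.lookup (Var i * p) u =
    (if Poly_Mapping.lookup u i = 0 then 0 else Poly_Mapping.lookup p (u - Poly_Mapping.single i 1))"
  by (simp add: Var_def lookup_single_times)

lemma Var_power2: "Var i ^ 2 = Poly_Mapping.single (Poly_Mapping.single i 2) 1"
  by (simp add: Var_def power2_eq_square mult_single numeral_2_eq_2 flip: single_add)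

lemma lookup_Q_times:
  "Poly_Mapping.lookup (Q * p) u = (\<Sum>i\<in>UNIV. if Poly_Mapping.lookup u i < 2 then 0
     else Poly_Mapping.lookup p (u - Poly_Mapping.single i 2))"
  by (simp add: Q_def sum_distrib_right lookup_sum Var_power2 lookup_single_times)

lemma lookup_Const_times: "Poly_Mapping.lookup (Const a * p) u = a * Poly_Mapping.lookup p u"
  using lookup_monom_times[of 0 a p u] by (simp add: Const_def)

lemma lookup_Const: "Poly_Mapping.lookup (Const a) u = (if u = 0 then a else 0)"
  by (auto simp: Const_def lookup_single when_def)

lemma Const_ring_hom:
  "Const 0 = 0"
  "Const (a + b) = Const a + Const b" "Const (a - b) = Const a - Const b"
  "Const (a * b) = Const a * Const b"
  by (simp_all add: Const_def single_add single_diff mult_single)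

section \<open>Partial derivatives and the operators \<open>M\<close>\<close>

lemma lookup_partial:
  "Poly_Mapping.lookup (partial j p) u =
     of_nat (Suc (Poly_Mapping.lookup u j)) * Poly_Mapping.lookup p (u + Poly_Mapping.single j 1)"
proof -
  let ?e = "Poly_Mapping.single j (1::nat)"
  let ?g = "\<lambda>v. of_nat (Poly_Mapping.lookup v j) * Poly_Mapping.lookup p v"
  \<comment> \<open>Truncation lets \<open>v - ?e = u\<close> hold also for \<open>v = u\<close>
    without the variable \<open>j\<close>; the factor \<open>of_nat 0\<close> removes that extra
    term.\<close>
  have eq: "(?g v when v - ?e = u) = (?g v when v = u + ?e)" for v
  proof (cases "Poly_Mapping.lookup v j = 0")
    case False
    then have "v = ?e + (v - ?e)" by (intro add_diff_single) simp
    then have "v - ?e = u \<longleftrightarrow> v = u + ?e" by (metis add.commute add_diff_cancel_left')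
    then show ?thesis by simp
  qed simp
  have "Poly_Mapping.lookup (partial j p) u = (\<Sum>v\<in>Poly_Mapping.keys p. ?g v when v = u + ?e)"
    by (simp only: partial_def lookup_sum lookup_single eq)
  also have "\<dots> = ?g (u + ?e)"
    by (simp add: when_def in_keys_iff)
  finally show ?thesis by (simp add: lookup_add)
qed

lemma partial_add: "partial j (p + q) = partial j p + partial j q"
  by (intro poly_mapping_eqI) (simp add: lookup_partial lookup_add algebra_simps)

lemma partial_diff: "partial j (p - q) = partial j p - partial j q"
  by (intro poly_mapping_eqI) (simp add: lookup_partial lookup_minus algebra_simps)

lemma partial_sum: "partial j (\<Sum>x\<in>A. f x) = (\<Sum>x\<in>A. partial j (f x))"
  by (intro poly_mapping_eqI) (simp add: lookup_partial lookup_sum sum_distrib_left)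

lemma partial_Const_times: "partial j (Const a * p) = Const a * partial j p"
  by (intro poly_mapping_eqI) (simp add: lookup_partial lookup_Const_times mult.left_commute)

lemma partial_Const: "partial j (Const a) = 0"
proof (intro poly_mapping_eqI)
  fix u :: "'a \<Rightarrow>\<^sub>0 nat"
  have "Poly_Mapping.lookup (u + Poly_Mapping.single j 1) j \<noteq> 0"
    by (simp add: lookup_add)
  then have "u + Poly_Mapping.single j 1 \<noteq> 0" by (metis lookup_zero)
  then show "Poly_Mapping.lookup (partial j (Const a)) u = Poly_Mapping.lookup 0 u"
    by (simp add: lookup_partial lookup_Const)
qed

text \<open>The Leibniz rule for one variable as a factor. Together with linearity it yields the
  rule for \<open>Q\<close>, so the general Leibniz rule is avoided.\<close>

lemma partial_Var_times:
  "partial j (Var i * p) = Var i * partial j p + (if i = j then p else 0)"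
proof (intro poly_mapping_eqI)
  fix u
  let ?e = "\<lambda>k. Poly_Mapping.single k (1::nat)"
  show "Poly_Mapping.lookup (partial j (Var i * p)) u =
    Poly_Mapping.lookup (Var i * partial j p + (if i = j then p else 0)) u"
  proof (cases "Poly_Mapping.lookup u i = 0")
    case True
    then show ?thesis
      by (auto simp: lookup_partial lookup_Var_times lookup_add lookup_single when_def)
  next
    case False
    then have "u + ?e j - ?e i = u - ?e i + ?e j"
      by (intro poly_mapping_eqI) (auto simp: lookup_add lookup_minus lookup_single when_def)
    moreover have "u + ?e j - ?e j = u" by simp
    moreover obtain m where "Poly_Mapping.lookup u i = Suc m"
      using False not0_implies_Suc by blast
    ultimately show ?thesis
      by (auto simp: lookup_partial lookup_Var_times lookup_add lookup_minus lookup_single when_def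
        distrib_right add_ac)
  qed
qed

lemma partial_Q_times: "partial j (Q * p) = Q * partial j p + 2 * Var j * p"
proof -
  have "partial j (Var i ^ 2 * p) = Var i ^ 2 * partial j p + (if i = j then 2 * Var j * p else 0)" for i
    by (simp add: power2_eq_square mult.assoc partial_Var_times) (simp add: algebra_simps)
  then show ?thesis
    by (simp add: Q_def sum_distrib_right partial_sum sum.distrib)
qed

lemma M_diff: "M j k (p - q) = M j k p - M j k q"
  by (simp add: M_def partial_diff algebra_simps)

lemma M_Const: "M j k (Const a) = 0"
  by (simp add: M_def partial_Const)

text \<open>\<open>M j k\<close> is a derivation that kills \<open>Q\<close> and constants: the two
  contributions of the derivatives of \<open>Q\<close>, both \<open>2 * Var j * Var k * p\<close>,
  cancel. Hence \<open>M j k\<close> acts on residues modulo \<open>Q - Const c\<close>.\<close>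

lemma M_Q_minus_Const_times: "M j k ((Q - Const c) * p) = (Q - Const c) * M j k p"
  by (simp add: M_def left_diff_distrib partial_diff partial_Q_times partial_Const_times)
    (simp add: algebra_simps)

text \<open>Peeling off one variable at a time reduces the existence of normal forms to
  multiplication by a single variable.\<close>

lemma mpol_induct [case_names Const add Var_times]:
  fixes p :: "('n::finite, 'a::comm_ring_1) mpol"
  assumes Const: "\<And>a. P (Const a)" and add: "\<And>p q. P p \<Longrightarrow> P q \<Longrightarrow> P (p + q)"
    and Var: "\<And>i p. P p \<Longrightarrow> P (Var i * p)"
  shows "P p"
proof (induction p rule: poly_mapping_induct)
  case (single u a)
  show ?case
  proof (induction "mon_degree u" arbitrary: u)
    case 0
    then have "u = 0" by (intro poly_mapping_eqI) (simp add: mon_degree_def)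
    then show ?case using Const[of a] by (simp add: Const_def)
  next
    case (Suc n)
    have "\<exists>i. Poly_Mapping.lookup u i \<noteq> 0"
      using Suc(2) unfolding mon_degree_def by (metis nat.distinct(1) sum.neutral)
    then obtain i where i: "Poly_Mapping.lookup u i \<noteq> 0" by blast
    define v where "v = u - Poly_Mapping.single i 1"
    have u: "u = Poly_Mapping.single i 1 + v"
      unfolding v_def using i by (intro add_diff_single) simp
    have "mon_degree u = Suc (mon_degree v)"
      by (simp add: u mon_degree_def lookup_add lookup_single sum.distrib when_def)
    then have "P (Poly_Mapping.single v a)" using Suc by simp
    then have "P (Var i * Poly_Mapping.single v a)" by (rule Var)
    then show ?case by (simp add: Var_def mult_single u)
  qed
next
  case (add f g)
  then show ?case by (rule assms(2))
qed


section \<open>Degrees and extremal monomials\<close>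

lemma mon_degree_add: "mon_degree (u + v) = mon_degree u + mon_degree v"
  by (simp add: mon_degree_def lookup_add sum.distrib)

lemma mon_degree_single: "mon_degree (Poly_Mapping.single i n) = n"
  by (simp add: mon_degree_def lookup_single when_def)

lemma mon_degree_diff_single:
  assumes "n \<le> Poly_Mapping.lookup u i"
  shows "mon_degree u = n + mon_degree (u - Poly_Mapping.single i n)"
  using add_diff_single[OF assms] by (metis mon_degree_add mon_degree_single)

lemma mon_degree_le_total_degree:
  "Poly_Mapping.lookup p u \<noteq> 0 \<Longrightarrow> mon_degree u \<le> total_degree p"
  unfolding total_degree_def by (intro Max_ge) (auto simp: in_keys_iff)

lemma total_degree_le_iff:
  "total_degree p \<le> n \<longleftrightarrow> (\<forall>u. Poly_Mapping.lookup p u \<noteq> 0 \<longrightarrow> mon_degree u \<le> n)"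
  by (auto simp: total_degree_def in_keys_iff)

text \<open>Selects a leading monomial. The weight \<open>w\<close> will be the degree in one
  variable, the total degree, or a mixture of both.\<close>

lemma ex_key_maximal:
  fixes w :: "_ \<Rightarrow> nat"
  assumes "Poly_Mapping.lookup p v \<noteq> 0"
  obtains u where "Poly_Mapping.lookup p u \<noteq> 0"
    "\<And>u'. w u < w u' \<Longrightarrow> Poly_Mapping.lookup p u' = 0"
proof -
  have fin: "finite (w ` Poly_Mapping.keys p)" and "w ` Poly_Mapping.keys p \<noteq> {}"
    using assms by (auto simp: in_keys_iff)
  then obtain u where u: "u \<in> Poly_Mapping.keys p" "w u = Max (w ` Poly_Mapping.keys p)"
    by (metis Max_in imageE)
  show ?thesis
  proof
    show "Poly_Mapping.lookup p u \<noteq> 0" using u by (simp add: in_keys_iff)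
    show "Poly_Mapping.lookup p u' = 0" if "w u < w u'" for u'
      using that fin u(2) by (metis Max_ge image_eqI in_keys_iff leD)
  qed
qed

text \<open>The hypothesis kills every summand of \<open>Q\<close> except \<open>Var i ^ 2\<close>.
  That one has coefficient 1, so the value survives even if the ring has zero divisors.\<close>

lemma lookup_Q_times_extremal:
  assumes "\<And>j. j \<noteq> i \<Longrightarrow> 2 \<le> Poly_Mapping.lookup u j \<Longrightarrow>
    Poly_Mapping.lookup p (u + Poly_Mapping.single i 2 - Poly_Mapping.single j 2) = 0"
  shows "Poly_Mapping.lookup (Q * p) (u + Poly_Mapping.single i 2) = Poly_Mapping.lookup p u"
proof -
  have "Poly_Mapping.lookup (Q * p) (u + Poly_Mapping.single i 2) =
    (\<Sum>j\<in>UNIV. if j = i then Poly_Mapping.lookup p u else 0)"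
    unfolding lookup_Q_times using assms
    by (intro sum.cong) (auto simp: lookup_add lookup_single when_def)
  then show ?thesis by simp
qed

section \<open>Normal forms modulo \<open>Q - Const c\<close>\<close>

text \<open>Stated through coefficients, so that polynomials in fewer variables stay in the same
  type.\<close>

definition free_of :: "'n::finite \<Rightarrow> ('n, 'a::comm_ring_1) mpol \<Rightarrow> bool" where
  "free_of i p \<longleftrightarrow> (\<forall>u. Poly_Mapping.lookup u i \<noteq> 0 \<longrightarrow> Poly_Mapping.lookup p u = 0)"

lemma free_of_lookup: "free_of i p \<Longrightarrow> Poly_Mapping.lookup u i \<noteq> 0 \<Longrightarrow> Poly_Mapping.lookup p u = 0"
  by (simp add: free_of_def)

lemma free_of_add: "free_of i p \<Longrightarrow> free_of i q \<Longrightarrow> free_of i (p + q)"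
  by (simp add: free_of_def lookup_add)

lemma free_of_diff: "free_of i p \<Longrightarrow> free_of i q \<Longrightarrow> free_of i (p - q)"
  by (simp add: free_of_def lookup_minus)

lemma free_of_Const_times: "free_of i p \<Longrightarrow> free_of i (Const a * p)"
  by (simp add: free_of_def lookup_Const_times)

lemma free_of_Const: "free_of i (Const a)"
  by (auto simp: free_of_def lookup_Const)

lemma free_of_Var_times: "j \<noteq> i \<Longrightarrow> free_of i p \<Longrightarrow> free_of i (Var j * p)"
  by (simp add: free_of_def lookup_Var_times lookup_minus lookup_single when_def)

lemma free_of_partial: "free_of i p \<Longrightarrow> free_of i (partial k p)"
  by (simp add: free_of_def lookup_partial lookup_add)

lemma partial_free_of: "free_of i p \<Longrightarrow> partial i p = 0"
  by (intro poly_mapping_eqI) (simp add: free_of_def lookup_partial lookup_add)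

lemma free_of_Q_minus_Var_times:
  fixes p :: "('n::finite, 'a::comm_ring_1) mpol"
  assumes "free_of i p"
  shows "free_of i ((Q - Var i ^ 2) * p)"
proof -
  have "(Q :: ('n, 'a) mpol) - Var i ^ 2 = (\<Sum>j\<in>UNIV - {i}. Var j ^ 2)"
    by (simp add: Q_def sum_diff)
  then have "(Q - Var i ^ 2) * p = (\<Sum>j\<in>UNIV - {i}. Var j ^ 2 * p)"
    by (simp only: sum_distrib_right)
  moreover have "free_of i (Var j ^ 2 * p)" if "j \<noteq> i" for j
    using assms that by (simp add: power2_eq_square mult.assoc free_of_Var_times)
  ultimately show ?thesis
    by (simp add: free_of_def lookup_sum)
qed

text \<open>Division with remainder by \<open>Q - Const c\<close>, which is monic of degree 2 in
  \<open>Var i\<close>.\<close>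

lemma normal_form_exists:
  obtains a b g where "free_of i a" "free_of i b" "p = a + Var i * b + (Q - Const c) * g"
proof -
  have "\<exists>a b g. free_of i a \<and> free_of i b \<and> p = a + Var i * b + (Q - Const c) * g"
  proof (induction p rule: mpol_induct)
    case (Const x)
    have "Const x = Const x + Var i * Const 0 + (Q - Const c) * 0"
      by (simp add: Const_ring_hom)
    then show ?case using free_of_Const by blast
  next
    case (add p q)
    then obtain a b g a' b' g' where
      *: "free_of i a" "free_of i b" "p = a + Var i * b + (Q - Const c) * g"
      "free_of i a'" "free_of i b'" "q = a' + Var i * b' + (Q - Const c) * g'" by blast
    have "p + q = (a + a') + Var i * (b + b') + (Q - Const c) * (g + g')"
      unfolding *(3,6) by (simp only: distrib_left add_ac)
    then show ?case using * free_of_add by blast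
  next
    case (Var_times j p)
    then obtain a b g where
      *: "free_of i a" "free_of i b" "p = a + Var i * b + (Q - Const c) * g" by blast
    show ?case
    proof (cases "j = i")
      case True
      \<comment> \<open>The only product that needs reduction: \<open>Var i ^ 2 * b\<close> is
        replaced by \<open>(Const c - (Q - Var i ^ 2)) * b\<close>, and the quotient grows by
        \<open>b\<close>.\<close>
      have "Var j * p = (Const c * b - (Q - Var i ^ 2) * b) + Var i * a + (Q - Const c) * (b + Var i * g)"
        unfolding *(3) True by (simp add: algebra_simps power2_eq_square)
      moreover have "free_of i (Const c * b - (Q - Var i ^ 2) * b)"
        using * by (intro free_of_diff free_of_Const_times free_of_Q_minus_Var_times)
      ultimately show ?thesis using * by blast
    next
      case False
      have "Var j * p = Var j * a + Var i * (Var j * b) + (Q - Const c) * (Var j * g)"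
        unfolding *(3) by (simp add: algebra_simps)
      then show ?thesis using * free_of_Var_times[OF False] by blast
    qed
  qed
  then show ?thesis using that by blast
qed

text \<open>Since the divisor is monic of degree 2 in \<open>Var i\<close>, a leading term of the
  quotient with respect to \<open>Var i\<close>, multiplied by \<open>Var i ^ 2\<close>, cannot
  cancel.\<close>

lemma dvd_imp_zero:
  assumes dvd: "(Q - Const c) dvd f"
    and le: "\<And>u. Poly_Mapping.lookup f u \<noteq> 0 \<Longrightarrow> Poly_Mapping.lookup u i \<le> 1"
  shows "f = 0"
proof (rule ccontr)
  assume "f \<noteq> 0"
  obtain g where f: "f = (Q - Const c) * g" using dvd by (elim dvdE)
  with \<open>f \<noteq> 0\<close> have "g \<noteq> 0" by auto
  then obtain v where "Poly_Mapping.lookup g v \<noteq> 0"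
    by (metis lookup_zero poly_mapping_eqI)
  then obtain u where u: "Poly_Mapping.lookup g u \<noteq> 0"
    and max: "\<And>v. Poly_Mapping.lookup u i < Poly_Mapping.lookup v i \<Longrightarrow> Poly_Mapping.lookup g v = 0"
    using ex_key_maximal[where w = "\<lambda>u. Poly_Mapping.lookup u i"] by metis
  have "Poly_Mapping.lookup (Q * g) (u + Poly_Mapping.single i 2) = Poly_Mapping.lookup g u"
    by (intro lookup_Q_times_extremal max) (simp add: lookup_add lookup_minus lookup_single when_def)
  moreover have "Poly_Mapping.lookup g (u + Poly_Mapping.single i 2) = 0"
    by (intro max) (simp add: lookup_add)
  ultimately have "Poly_Mapping.lookup f (u + Poly_Mapping.single i 2) \<noteq> 0"
    using u by (simp add: f left_diff_distrib lookup_minus lookup_Const_times)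
  then show False using le by (fastforce simp: lookup_add)
qed

lemma normal_form_unique:
  assumes a: "free_of i a" and b: "free_of i b" and dvd: "(Q - Const c) dvd a + Var i * b"
  shows "a = 0" "b = 0"
proof -
  have eq: "a + Var i * b = 0"
  proof (rule dvd_imp_zero[OF dvd])
    fix u assume u: "Poly_Mapping.lookup (a + Var i * b) u \<noteq> 0"
    show "Poly_Mapping.lookup u i \<le> 1"
    proof (rule ccontr)
      assume "\<not> ?thesis"
      then have "Poly_Mapping.lookup a u = 0"
        "Poly_Mapping.lookup b (u - Poly_Mapping.single i 1) = 0"
        by (auto intro!: free_of_lookup[OF a] free_of_lookup[OF b] simp: lookup_minus)
      with u show False by (simp add: lookup_add lookup_Var_times split: if_splits)
    qed
  qed
  \<comment> \<open>At \<open>u + Poly_Mapping.single i 1\<close> the part \<open>a\<close>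
    contributes nothing, so the coefficient of \<open>b\<close> at \<open>u\<close> stands
    alone.\<close>
  have "Poly_Mapping.lookup b u = 0" for u
    using arg_cong[OF eq, of "\<lambda>p. Poly_Mapping.lookup p (u + Poly_Mapping.single i 1)"]
      free_of_lookup[OF a, of "u + Poly_Mapping.single i 1"]
    by (simp add: lookup_add lookup_Var_times)
  then show "b = 0" by (intro poly_mapping_eqI) simp
  with eq show "a = 0" by simp
qed

section \<open>Statement (i)\<close>

lemma Const_eqI:
  assumes "\<And>u. u \<noteq> 0 \<Longrightarrow> Poly_Mapping.lookup p u = 0"
  shows "p = Const (Poly_Mapping.lookup p 0)"
  using assms by (intro poly_mapping_eqI) (auto simp: lookup_Const)

text \<open>Let \<open>b\<close> have degree \<open>e\<close> in \<open>Var k\<close>. As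
  \<open>i\<close> differs from \<open>k\<close>, \<open>Q - Var i ^ 2\<close> contains
  \<open>Var k ^ 2\<close>, so in degree \<open>e + 1\<close> the equation says that
  \<open>- (e + 1)\<close> times the leading coefficient is zero.\<close>

lemma partial_eq_Var_times_imp_zero:
  fixes b :: "('n::finite, 'a::comm_ring_1) mpol"
  assumes torsion_free: "\<forall>n. not_zero_divisor (of_nat (Suc n) :: 'a)"
    and "i \<noteq> k"
    and eq: "Const c * partial k b - (Q - Var i ^ 2) * partial k b - Var k * b = 0"
  shows "b = 0"
proof (rule ccontr)
  let ?e = "\<lambda>i. Poly_Mapping.single i (1::nat)" and ?e2 = "\<lambda>i. Poly_Mapping.single i (2::nat)"
  assume "b \<noteq> 0"
  then obtain v where "Poly_Mapping.lookup b v \<noteq> 0"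
    by (metis lookup_zero poly_mapping_eqI)
  then obtain u where u: "Poly_Mapping.lookup b u \<noteq> 0"
    and max: "\<And>v. Poly_Mapping.lookup u k < Poly_Mapping.lookup v k \<Longrightarrow> Poly_Mapping.lookup b v = 0"
    using ex_key_maximal[where w = "\<lambda>u. Poly_Mapping.lookup u k"] by metis
  have vanish: "Poly_Mapping.lookup (partial k b) v = 0"
    if "Poly_Mapping.lookup u k \<le> Poly_Mapping.lookup v k" for v
    using that by (simp add: lookup_partial max lookup_add)
  \<comment> \<open>Only the summand \<open>Var k ^ 2\<close> of \<open>Q\<close> lowers the
    exponent of \<open>Var k\<close> below that in \<open>u\<close>; all others meet
    \<open>vanish\<close>.\<close>
  have "Poly_Mapping.lookup (Q * partial k b) (u + ?e k) =
    (\<Sum>j\<in>UNIV. if j = k then of_nat (Poly_Mapping.lookup u k) * Poly_Mapping.lookup b u else 0)"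
    unfolding lookup_Q_times
  proof (intro sum.cong refl)
    fix j
    show "(if Poly_Mapping.lookup (u + ?e k) j < 2 then 0
        else Poly_Mapping.lookup (partial k b) (u + ?e k - ?e2 j)) =
      (if j = k then of_nat (Poly_Mapping.lookup u k) * Poly_Mapping.lookup b u else 0)"
    \<comment> \<open>If \<open>u\<close> lacks the variable \<open>k\<close>, then
      \<open>u + ?e k\<close> has exponent 1 there and the summand \<open>j = k\<close> is zero on
      both sides as well.\<close>
    proof (cases "j = k \<and> Poly_Mapping.lookup u k \<noteq> 0")
      case True
      then have "u + ?e k - ?e2 k + ?e k = u"
        by (intro poly_mapping_eqI) (auto simp: lookup_add lookup_minus lookup_single when_def)
      with True show ?thesis
        by (simp add: lookup_partial lookup_add lookup_minus)
    next
      case False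
      then show ?thesis
        by (auto intro!: vanish simp: lookup_add lookup_minus lookup_single when_def)
    qed
  qed
  moreover have "Poly_Mapping.lookup (Var i ^ 2 * partial k b) (u + ?e k) = 0"
    using \<open>i \<noteq> k\<close>
    by (simp add: Var_power2 lookup_single_times vanish lookup_add lookup_minus lookup_single when_def)
  moreover have "Poly_Mapping.lookup (Const c * partial k b) (u + ?e k) = 0"
    by (simp add: lookup_Const_times vanish lookup_add)
  moreover have "Poly_Mapping.lookup (Var k * b) (u + ?e k) = Poly_Mapping.lookup b u"
    by (simp add: lookup_Var_times lookup_add)
  moreover have "Poly_Mapping.lookup (Const c * partial k b) (u + ?e k) -
      (Poly_Mapping.lookup (Q * partial k b) (u + ?e k) -
        Poly_Mapping.lookup (Var i ^ 2 * partial k b) (u + ?e k)) -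
      Poly_Mapping.lookup (Var k * b) (u + ?e k) = 0"
    using arg_cong[OF eq, of "\<lambda>p. Poly_Mapping.lookup p (u + ?e k)"]
    by (simp only: left_diff_distrib lookup_minus lookup_zero)
  ultimately have "- (of_nat (Suc (Poly_Mapping.lookup u k)) * Poly_Mapping.lookup b u) = 0"
    by (simp add: distrib_right)
  then have "of_nat (Suc (Poly_Mapping.lookup u k)) * Poly_Mapping.lookup b u = 0"
    by (simp only: neg_equal_0_iff_equal)
  then show False using torsion_free u unfolding not_zero_divisor_def by blast
qed

lemma constant_modulo_Q_minus_Const:
  fixes p :: "('n::finite, 'a::comm_ring_1) mpol"
  assumes torsion_free: "\<forall>n. not_zero_divisor (of_nat (Suc n) :: 'a)"
    and "i \<noteq> k0"
    and dvd: "\<And>k. i \<noteq> k \<Longrightarrow> (Q - Const c) dvd M i k p"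
  shows "\<exists>c'. (Q - Const c) dvd p - Const c'"
proof -
  obtain a b g where a: "free_of i a" and b: "free_of i b"
    and p: "p = a + Var i * b + (Q - Const c) * g" by (rule normal_form_exists)
  have 0: "partial k a = 0"
      "Const c * partial k b - (Q - Var i ^ 2) * partial k b - Var k * b = 0" if "i \<noteq> k" for k
  proof -
    let ?b = "Const c * partial k b - (Q - Var i ^ 2) * partial k b - Var k * b"
    have "p - (Q - Const c) * g = a + Var i * b" by (simp add: p)
    then have "M i k p - (Q - Const c) * M i k g = M i k (a + Var i * b)"
      by (metis M_diff M_Q_minus_Const_times)
    \<comment> \<open>The term \<open>Var i ^ 2 * partial k b\<close> is again reduced modulo
      \<open>Q - Const c\<close>; this brings the right side into normal form up to a multiple of
      the divisor.\<close>
    also have "\<dots> = ?b + Var i * partial k a + (Q - Const c) * partial k b"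
      using that a b
      by (simp add: M_def partial_add partial_Var_times partial_free_of)
        (simp add: algebra_simps power2_eq_square)
    finally have "?b + Var i * partial k a = M i k p - (Q - Const c) * (M i k g + partial k b)"
      by (simp add: algebra_simps)
    then have dvd': "(Q - Const c) dvd ?b + Var i * partial k a"
      using dvd[OF that] by (simp only: dvd_diff dvd_triv_left)
    have free: "free_of i ?b" "free_of i (partial k a)"
      using a b that
      by (auto intro!: free_of_diff free_of_Const_times free_of_Q_minus_Var_times free_of_Var_times
        free_of_partial)
    show "partial k a = 0" "?b = 0" using normal_form_unique[OF free dvd'] by auto
  qed
  have "b = 0" by (rule partial_eq_Var_times_imp_zero[OF torsion_free \<open>i \<noteq> k0\<close> 0(2)[OF \<open>i \<noteq> k0\<close>]])
  \<comment> \<open>A nonconstant monomial contains \<open>Var i\<close>, which \<open>a\<close> is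
    free of, or some other variable, with respect to which the derivative of \<open>a\<close> is
    zero.\<close>
  have "Poly_Mapping.lookup a u = 0" if "u \<noteq> 0" for u
  proof -
    obtain k where k: "Poly_Mapping.lookup u k \<noteq> 0"
      using \<open>u \<noteq> 0\<close> by (metis lookup_zero poly_mapping_eqI)
    show ?thesis
    proof (cases "k = i")
      case True
      then show ?thesis using free_of_lookup[OF a] k by blast
    next
      case False
      define v where "v = u - Poly_Mapping.single k 1"
      have u: "u = v + Poly_Mapping.single k 1"
        using add_diff_single[of 1 u k] k by (simp add: v_def add.commute)
      have "Poly_Mapping.lookup (partial k a) v = 0" using 0(1)[of k] False by simp
      then show ?thesis
        using torsion_free unfolding lookup_partial u not_zero_divisor_def by blast
    qed
  qed
  then have "a = Const (Poly_Mapping.lookup a 0)" by (rule Const_eqI)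
  then have "p - Const (Poly_Mapping.lookup a 0) = (Q - Const c) * g"
    using p \<open>b = 0\<close> by simp
  then show ?thesis by (metis dvd_triv_left)
qed


section \<open>Cancellation and degrees for multiples of \<open>Q - Const c\<close>\<close>

text \<open>Modulo \<open>Q - Const c\<close> the factor \<open>Q - Const e\<close> is the constant
  \<open>c - e\<close>. It multiplies the two components of a normal form coefficientwise, so it can
  be cancelled there.\<close>

lemma dvd_cancel_Q_minus_Const:
  assumes e: "not_zero_divisor (c - e)" and dvd: "(Q - Const c) dvd (Q - Const e) * f"
  shows "(Q - Const c) dvd f"
proof -
  fix i
  obtain a b g where a: "free_of i a" and b: "free_of i b"
    and f: "f = a + Var i * b + (Q - Const c) * g" by (rule normal_form_exists)
  have "Const (c - e) * a + Var i * (Const (c - e) * b) =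
      (Q - Const e) * f - (Q - Const c) * (f + Const (c - e) * g)"
    by (simp add: f Const_ring_hom algebra_simps)
  then have "(Q - Const c) dvd Const (c - e) * a + Var i * (Const (c - e) * b)"
    using dvd by (simp only: dvd_diff dvd_triv_left)
  then have 0: "Const (c - e) * a = 0" "Const (c - e) * b = 0"
    using normal_form_unique[OF free_of_Const_times[OF a] free_of_Const_times[OF b]] by blast+
  have cancel: "p = 0" if "Const (c - e) * p = 0" for p
    using that e by (intro poly_mapping_eqI) (metis lookup_Const_times lookup_zero not_zero_divisor_def)
  show ?thesis using 0[THEN cancel] by (simp add: f)
qed

text \<open>Degrees need not add over a ring with zero divisors; here they do not drop because
  \<open>Var i ^ 2\<close> has coefficient 1 in \<open>Q\<close>.\<close>

lemma total_degree_Q_minus_Const_times: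
  fixes g :: "('n::finite, 'a::comm_ring_1) mpol"
  assumes "g \<noteq> 0"
  shows "total_degree g + 2 \<le> total_degree ((Q - Const c) * g)"
proof -
  fix i :: 'n
  obtain v where "Poly_Mapping.lookup g v \<noteq> 0"
    using assms by (metis lookup_zero poly_mapping_eqI)
  then obtain v where v: "Poly_Mapping.lookup g v \<noteq> 0"
    and max: "\<And>u. mon_degree v < mon_degree u \<Longrightarrow> Poly_Mapping.lookup g u = 0"
    using ex_key_maximal[where w = mon_degree] by metis
  \<comment> \<open>Among the monomials of top degree take one of maximal degree in \<open>X\<^sub>i\<close>; then its product
    with \<open>X\<^sub>i\<^sup>2\<close> arises in only one way.\<close>
  let ?w = "\<lambda>u. if mon_degree u = mon_degree v then Suc (Poly_Mapping.lookup u i) else 0"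
  obtain u where u: "Poly_Mapping.lookup g u \<noteq> 0"
    and umax: "\<And>u'. ?w u < ?w u' \<Longrightarrow> Poly_Mapping.lookup g u' = 0"
    using ex_key_maximal[OF v, of ?w] by metis
  \<comment> \<open>The \<open>Suc\<close> in the weight ranks every monomial of top degree, even
    one without \<open>Var i\<close>, above all those of lower degree.\<close>
  have deg_u: "mon_degree u = mon_degree v"
  proof (rule ccontr)
    assume "mon_degree u \<noteq> mon_degree v"
    then show False using umax[of v] v by simp
  qed
  have "Poly_Mapping.lookup (Q * g) (u + Poly_Mapping.single i 2) = Poly_Mapping.lookup g u"
  proof (intro lookup_Q_times_extremal umax)
    fix j
    assume j: "j \<noteq> i" "2 \<le> Poly_Mapping.lookup u j"
    let ?u' = "u + Poly_Mapping.single i 2 - Poly_Mapping.single j 2"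
    have "mon_degree (u + Poly_Mapping.single i 2) = 2 + mon_degree ?u'"
      using j by (intro mon_degree_diff_single) (simp add: lookup_add)
    then have "mon_degree ?u' = mon_degree v"
      by (simp add: mon_degree_add mon_degree_single deg_u)
    then show "?w u < ?w ?u'"
      using j by (simp add: deg_u lookup_add lookup_minus lookup_single when_def)
  qed
  moreover have "Poly_Mapping.lookup g (u + Poly_Mapping.single i 2) = 0"
    by (intro max) (simp add: mon_degree_add mon_degree_single deg_u)
  ultimately have "Poly_Mapping.lookup ((Q - Const c) * g) (u + Poly_Mapping.single i 2) \<noteq> 0"
    using u by (simp add: left_diff_distrib lookup_minus lookup_Const_times)
  then have "mon_degree v + 2 \<le> total_degree ((Q - Const c) * g)"
    using mon_degree_le_total_degree by (fastforce simp: mon_degree_add mon_degree_single deg_u)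
  moreover have "total_degree g \<le> mon_degree v"
    unfolding total_degree_le_iff using max not_le by blast
  ultimately show ?thesis by simp
qed

text \<open>For a nonzero quotient \<open>g\<close>, the lowest terms of \<open>g\<close> times
  \<open>- c\<close> survive in \<open>f\<close>, so \<open>d\<close> is at most the degree of
  \<open>g\<close>; but \<open>f\<close> has degree at least 2 more than \<open>g\<close>.\<close>

lemma homogeneous_dvd_imp_zero:
  assumes "homogeneous d f" "not_zero_divisor c" "(Q - Const c) dvd f"
  shows "f = 0"
proof (rule ccontr)
  assume "f \<noteq> 0"
  obtain g where f: "f = (Q - Const c) * g" using assms(3) by (elim dvdE)
  with \<open>f \<noteq> 0\<close> have "g \<noteq> 0" by auto
  have deg: "mon_degree u = d" if "Poly_Mapping.lookup f u \<noteq> 0" for u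
    using that assms(1) by (simp add: homogeneous_def in_keys_iff)
  let ?P = "\<lambda>u. Poly_Mapping.lookup g u \<noteq> 0"
  have "\<exists>u. ?P u" using \<open>g \<noteq> 0\<close> by (metis lookup_zero poly_mapping_eqI)
  then obtain u where u: "?P u" and min: "\<And>v. ?P v \<Longrightarrow> mon_degree u \<le> mon_degree v"
    using ex_has_least_nat[of ?P] by metis
  \<comment> \<open>A contribution would come from a monomial of \<open>g\<close> of degree 2 below
    the minimum.\<close>
  have "Poly_Mapping.lookup (Q * g) u = 0"
    unfolding lookup_Q_times
  proof (intro sum.neutral ballI)
    fix j
    show "(if Poly_Mapping.lookup u j < 2 then 0
        else Poly_Mapping.lookup g (u - Poly_Mapping.single j 2)) = 0"
      using min[of "u - Poly_Mapping.single j 2"] mon_degree_diff_single[of 2 u j]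
      by (cases "Poly_Mapping.lookup u j < 2") force+
  qed
  then have "Poly_Mapping.lookup f u = - (c * Poly_Mapping.lookup g u)"
    by (simp add: f left_diff_distrib lookup_minus lookup_Const_times)
  with u assms(2) have "mon_degree u = d"
    by (intro deg) (auto simp: not_zero_divisor_def)
  then have "d \<le> total_degree g" using mon_degree_le_total_degree[OF u] by simp
  moreover have "total_degree f \<le> d"
    unfolding total_degree_le_iff using deg by auto
  ultimately show False
    using total_degree_Q_minus_Const_times[OF \<open>g \<noteq> 0\<close>, of c] f by simp
qed

lemma homogeneous_M:
  assumes "homogeneous d p"
  shows "homogeneous d (M j k p)"
proof -
  have *: "mon_degree u = d"
    if nz: "Poly_Mapping.lookup (Var j * partial k p) u \<noteq> 0" for j k u
  proof -
    let ?v = "u - Poly_Mapping.single j 1 + Poly_Mapping.single k 1"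
    have j: "Poly_Mapping.lookup u j \<noteq> 0" and "Poly_Mapping.lookup p ?v \<noteq> 0"
      using nz by (auto simp: lookup_Var_times lookup_partial split: if_splits)
    then have "mon_degree ?v = d"
      using assms by (simp add: homogeneous_def in_keys_iff)
    then show ?thesis
      using mon_degree_diff_single[of 1 u j] j by (simp add: mon_degree_add mon_degree_single)
  qed
  show ?thesis
    unfolding homogeneous_def M_def using *
    by (metis diff_self in_keys_iff lookup_minus)
qed

section \<open>Polynomials in \<open>Q\<close>\<close>

lemma poly_map_Const_pCons:
  fixes q :: "('n::finite, 'a::comm_ring_1) mpol"
  shows "poly (map_poly Const (pCons a f)) q = Const a + q * poly (map_poly Const f) q"
proof -
  have "map_poly Const (pCons a f) = pCons (Const a :: ('n, 'a) mpol) (map_poly Const f)"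
    by (intro poly_eqI) (simp add: coeff_map_poly Const_ring_hom coeff_pCons split: nat.split)
  then show ?thesis by simp
qed

lemma polynomial_in_Const: "polynomial_in q (Const a)"
  unfolding polynomial_in_def using poly_map_Const_pCons[of a 0 q]
  by (metis add_0_right map_poly_0 mult_zero_right poly_0)

lemma polynomial_in_add:
  fixes q :: "('n::finite, 'a::comm_ring_1) mpol"
  assumes "polynomial_in q p" "polynomial_in q p'"
  shows "polynomial_in q (p + p')"
proof -
  have "map_poly Const (f + g) = (map_poly Const f + map_poly Const g :: ('n, 'a) mpol poly)" for f g
    by (intro poly_eqI) (simp add: coeff_map_poly Const_ring_hom)
  then show ?thesis using assms unfolding polynomial_in_def by (metis poly_add)
qed

lemma polynomial_in_times:
  assumes "polynomial_in q p"
  shows "polynomial_in q (q * p)"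
  using assms poly_map_Const_pCons[of 0] unfolding polynomial_in_def
  by (metis Const_ring_hom(1) add_0_left)

lemma polynomial_in_Const_times:
  fixes q :: "('n::finite, 'a::comm_ring_1) mpol"
  assumes "polynomial_in q p"
  shows "polynomial_in q (Const a * p)"
proof -
  have "map_poly Const (smult a f) = smult (Const a :: ('n, 'a) mpol) (map_poly Const f)" for f
    by (intro poly_eqI) (simp add: coeff_map_poly Const_ring_hom)
  then show ?thesis using assms unfolding polynomial_in_def by (metis poly_smult)
qed

text \<open>Among the powers of \<open>Q\<close>, the pure power of \<open>Var i\<close> with
  exponent \<open>2 * k\<close> occurs only in \<open>Q ^ k\<close>, with coefficient 1. So
  \<open>f\<close> can be read off from its value at \<open>Q\<close>.\<close>

lemma lookup_poly_Q:
  "Poly_Mapping.lookup (poly (map_poly Const f) Q) (Poly_Mapping.single i (2 * k)) = coeff f k"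
proof (induction f arbitrary: k rule: pCons_induct)
  case (pCons a f)
  show ?case
  proof (cases k)
    case 0
    then show ?thesis
      by (simp add: poly_map_Const_pCons lookup_add lookup_Const lookup_Q_times)
  next
    case (Suc l)
    have e: "Poly_Mapping.single i (2 * k) = Poly_Mapping.single i (2 * l) + Poly_Mapping.single i 2"
      by (simp add: Suc flip: single_add)
    have "Poly_Mapping.single i (2 * k) \<noteq> 0"
      by (metis Suc lookup_single_eq lookup_zero mult_eq_0_iff nat.distinct(1) zero_neq_numeral)
    then show ?thesis
      unfolding poly_map_Const_pCons lookup_add lookup_Const unfolding e
      by (subst lookup_Q_times_extremal) (auto simp: Suc pCons lookup_single when_def)
  qed
qed simp

section \<open>Statements (ii) and (iii)\<close>

context
  fixes i k0 :: "'n::finite"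
  assumes torsion_free: "\<forall>n. not_zero_divisor (of_nat (Suc n) :: 'a::comm_ring_1)"
    and ik0: "i \<noteq> k0"
begin

text \<open>The degree enters as an upper bound and \<open>p\<close> may be zero, because the
  quotient in the induction step may be zero.\<close>

lemma polynomial_in_Q_if_dvd:
  fixes p :: "('n, 'a) mpol"
  assumes "\<forall>i\<in>{1..m}. \<forall>j\<in>{1..m}. i \<noteq> j \<longrightarrow> not_zero_divisor (c i - c j)"
    and "\<And>j k l. j \<noteq> k \<Longrightarrow> l \<in> {1..m} \<Longrightarrow> (Q - Const (c l)) dvd M j k p"
    and "total_degree p \<le> 2 * m"
  shows "polynomial_in Q p"
  using assms
proof (induction m arbitrary: p)
  case 0
  have "Poly_Mapping.lookup p u = 0" if "u \<noteq> 0" for u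
  proof (rule ccontr)
    assume "Poly_Mapping.lookup p u \<noteq> 0"
    then have "mon_degree u = 0" using 0(3) mon_degree_le_total_degree[of p u] by simp
    then have "u = 0" by (intro poly_mapping_eqI) (simp add: mon_degree_def)
    with that show False by simp
  qed
  then show ?case by (metis Const_eqI polynomial_in_Const)
next
  case (Suc m)
  let ?e = "c (Suc m)"
  have "(Q - Const ?e) dvd M i k p" if "i \<noteq> k" for k
    using Suc.prems(2) that by simp
  then obtain c' where "(Q - Const ?e) dvd p - Const c'"
    using constant_modulo_Q_minus_Const[OF torsion_free ik0] by blast
  then obtain g where g: "p - Const c' = (Q - Const ?e) * g" by (elim dvdE)
  have "polynomial_in Q g"
  proof (rule Suc.IH)
    show "\<forall>i\<in>{1..m}. \<forall>j\<in>{1..m}. i \<noteq> j \<longrightarrow> not_zero_divisor (c i - c j)"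
      using Suc.prems(1) by simp
    show "(Q - Const (c l)) dvd M j k g" if "j \<noteq> k" "l \<in> {1..m}" for j k l
    proof (rule dvd_cancel_Q_minus_Const)
      show "not_zero_divisor (c l - ?e)" using Suc.prems(1) that(2) by simp
      \<comment> \<open>\<open>M j k\<close> kills \<open>Const c'\<close> and passes through the
        factor \<open>Q - Const ?e\<close>, so the divisibility for \<open>p\<close> transfers to
        \<open>g\<close> after cancellation.\<close>
      have "M j k p = (Q - Const ?e) * M j k g"
        using arg_cong[OF g, of "M j k"] by (simp add: M_diff M_Const M_Q_minus_Const_times)
      then show "(Q - Const (c l)) dvd (Q - Const ?e) * M j k g"
        using Suc.prems(2)[OF that(1), of l] that(2) by simp
    qed
    have "total_degree (p - Const c') \<le> 2 * Suc m"
      unfolding total_degree_le_iff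
    proof (intro allI impI)
      fix u assume nz: "Poly_Mapping.lookup (p - Const c') u \<noteq> 0"
      show "mon_degree u \<le> 2 * Suc m"
      proof (cases "u = 0")
        case False
        then have "mon_degree u \<le> total_degree p"
          using nz by (intro mon_degree_le_total_degree) (simp add: lookup_minus lookup_Const)
        then show ?thesis using Suc.prems(3) by simp
      qed (simp add: mon_degree_def)
    qed
    then show "total_degree g \<le> 2 * m"
      \<comment> \<open>The degree drop requires \<open>g\<close> to be nonzero; the zero polynomial
        has degree 0 by convention.\<close>
      using total_degree_Q_minus_Const_times[of g ?e] g
      by (cases "g = 0") (simp add: total_degree_def, simp)
  qed
  moreover have "p = Q * g + Const (- ?e) * g + Const c'"
    using g by (simp add: algebra_simps Const_def single_uminus)
  ultimately show ?case
    by (metis polynomial_in_add polynomial_in_Const polynomial_in_Const_times polynomial_in_times)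
qed

lemma homogeneous_power_of_Q:
  fixes p :: "('n, 'a) mpol"
  assumes "p \<noteq> 0" and hom: "homogeneous d p" and "not_zero_divisor c"
    and "\<And>j k. j \<noteq> k \<Longrightarrow> (Q - Const c) dvd M j k p"
  shows "even d \<and> (\<exists>a. p = Const a * Q ^ (d div 2))"
proof -
  have M0: "M j k p = 0" if "j \<noteq> k" for j k
    using homogeneous_dvd_imp_zero[OF homogeneous_M[OF hom]] assms(3,4) that by blast
  \<comment> \<open>As all \<open>M j k p\<close> vanish, any constants will do; the naturals up to
    \<open>d\<close> have differences that are not zero divisors.\<close>
  have "polynomial_in Q p"
  proof (rule polynomial_in_Q_if_dvd[where m = d and c = of_nat])
    show "\<forall>i\<in>{1..d}. \<forall>j\<in>{1..d}. i \<noteq> j \<longrightarrow> not_zero_divisor (of_nat i - of_nat j :: 'a)"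
      unfolding not_zero_divisor_def
    proof (intro ballI allI impI)
      fix i j and x :: 'a
      assume "i \<noteq> j" and x: "(of_nat i - of_nat j) * x = 0"
      then consider n where "i = j + Suc n" | n where "j = i + Suc n"
        by (metis less_imp_Suc_add add_Suc_right linorder_neqE_nat)
      then show "x = 0"
      proof cases
        case 1
        with x have "of_nat (Suc n) * x = 0" by simp
        then show ?thesis using torsion_free unfolding not_zero_divisor_def by blast
      next
        case 2
        then have "(of_nat i - of_nat j) * x = - (of_nat (Suc n) * x)"
          by (simp add: algebra_simps)
        with x have "of_nat (Suc n) * x = 0" by simp
        then show ?thesis using torsion_free unfolding not_zero_divisor_def by blast
      qed
    qed
    show "total_degree p \<le> 2 * d"
      using hom by (auto simp: total_degree_le_iff homogeneous_def in_keys_iff)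
  qed (simp add: M0)
  then obtain f where f: "p = poly (map_poly Const f) Q"
    by (auto simp: polynomial_in_def)
  \<comment> \<open>Each nonzero coefficient of \<open>f\<close> shows up in \<open>p\<close> at a
    pure power of \<open>Var i\<close>, whose degree must be \<open>d\<close>; so \<open>f\<close>
    is a monomial.\<close>
  have coeff: "2 * k = d" if "coeff f k \<noteq> 0" for k
  proof -
    have "Poly_Mapping.lookup p (Poly_Mapping.single i (2 * k)) \<noteq> 0"
      using that by (simp add: f lookup_poly_Q)
    then have "mon_degree (Poly_Mapping.single i (2 * k)) = d"
      using hom by (simp add: homogeneous_def in_keys_iff)
    then show ?thesis by (simp add: mon_degree_single)
  qed
  have "f \<noteq> 0" using \<open>p \<noteq> 0\<close> f by auto
  then have d: "2 * degree f = d" by (intro coeff) simp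
  then have "f = monom (lead_coeff f) (d div 2)"
    using coeff by (intro poly_eqI) (force simp: coeff_monom)
  then have "map_poly Const f = monom (Const (lead_coeff f) :: ('n, 'a) mpol) (d div 2)"
    by (metis Const_ring_hom(1) map_poly_monom)
  then have "p = Const (lead_coeff f) * Q ^ (d div 2)"
    unfolding f by (simp only: poly_monom)
  with d show ?thesis by auto
qed

end

section \<open>Rational scalars and the final assembly\<close>

text \<open>The image of \<open>1 / of_nat (Suc n)\<close> under \<open>h\<close> is an inverse of
  \<open>of_nat (Suc n)\<close>. In this form the rationals enter all arguments above.\<close>

lemma rat_embedding_torsion_free:
  fixes h :: "rat \<Rightarrow> 'a::comm_ring_1"
  assumes "rat_embedding h"
  shows "not_zero_divisor (of_nat (Suc n) :: 'a)"
proof -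
  have add: "h (a + b) = h a + h b" and mult: "h (a * b) = h a * h b" and one: "h 1 = 1" for a b
    using assms(1) by (auto simp: rat_embedding_def)
  have "h 0 = 0" using add[of 0 0] by simp
  then have of_nat: "h (of_nat m) = of_nat m" for m
    by (induction m) (simp_all add: add one)
  have "h (1 / of_nat (Suc n)) * of_nat (Suc n) = h (1 / of_nat (Suc n) * of_nat (Suc n))"
    by (simp only: mult of_nat)
  also have "\<dots> = 1" by (simp add: one del: of_nat_Suc)
  finally have "x = h (1 / of_nat (Suc n)) * (of_nat (Suc n) * x)" for x
    by (simp flip: mult.assoc del: of_nat_Suc)
  then show ?thesis unfolding not_zero_divisor_def by (metis mult_zero_right)
qed

theorem proposition2p17:
  fixes p :: "('n::finite, 'a::comm_ring_1) mpol"
  assumes "\<exists>h :: rat \<Rightarrow> 'a. rat_embedding h"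
    and "CARD('n) \<ge> 2"
  shows
    "(\<forall>c::'a. (\<forall>j k. j \<noteq> k \<longrightarrow> (Q - Const c) dvd M j k p) \<longrightarrow>
        (\<exists>c'::'a. (Q - Const c) dvd (p - Const c'))) \<and>
     (\<forall>(d::nat) (m::nat) (c :: nat \<Rightarrow> 'a).
        p \<noteq> 0 \<and> total_degree p = d \<and> real m \<ge> real d / 2 \<and>
        (\<forall>i\<in>{1..m}. \<forall>j\<in>{1..m}. i \<noteq> j \<longrightarrow> not_zero_divisor (c i - c j)) \<and>
        (\<forall>j k. j \<noteq> k \<longrightarrow> (\<forall>i\<in>{1..m}. (Q - Const (c i)) dvd M j k p)) \<longrightarrow>
        polynomial_in Q p) \<and>
     (\<forall>(d::nat) (c::'a).
        p \<noteq> 0 \<and> homogeneous d p \<and> not_zero_divisor c \<and>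
        (\<forall>j k. j \<noteq> k \<longrightarrow> (Q - Const c) dvd M j k p) \<longrightarrow>
        even d \<and> (\<exists>a::'a. p = Const a * Q ^ (d div 2)))"
proof -
  obtain h :: "rat \<Rightarrow> 'a" where "rat_embedding h" using assms(1) by blast
  then have torsion_free: "\<forall>n. not_zero_divisor (of_nat (Suc n) :: 'a)"
    using rat_embedding_torsion_free by blast
  obtain i k :: 'n where ik: "i \<noteq> k"
    using assms(2) card_le_Suc0_iff_eq[of "UNIV :: 'n set"] by fastforce
  show ?thesis
  proof (intro conjI allI impI; (elim conjE)?)
    fix c :: 'a
    assume "\<forall>j k. j \<noteq> k \<longrightarrow> (Q - Const c) dvd M j k p"
    then show "\<exists>c'. (Q - Const c) dvd p - Const c'"
      using constant_modulo_Q_minus_Const[OF torsion_free ik] by blast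
  next
    fix d m :: nat and c :: "nat \<Rightarrow> 'a"
    assume "total_degree p = d" "real d / 2 \<le> real m"
      and c: "\<forall>i\<in>{1..m}. \<forall>j\<in>{1..m}. i \<noteq> j \<longrightarrow> not_zero_divisor (c i - c j)"
      and dvd: "\<forall>j k. j \<noteq> k \<longrightarrow> (\<forall>i\<in>{1..m}. (Q - Const (c i)) dvd M j k p)"
    then have "total_degree p \<le> 2 * m" by linarith
    then show "polynomial_in Q p"
      using dvd by (intro polynomial_in_Q_if_dvd[OF torsion_free ik c]) auto
  next
    fix d :: nat and c :: 'a
    assume "p \<noteq> 0" "homogeneous d p" "not_zero_divisor c"
      and "\<forall>j k. j \<noteq> k \<longrightarrow> (Q - Const c) dvd M j k p"
    then have *: "even d \<and> (\<exists>a. p = Const a * Q ^ (d div 2))"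
      using homogeneous_power_of_Q[OF torsion_free ik] by blast
    then show "even d" by blast
    from * show "\<exists>a. p = Const a * Q ^ (d div 2)" by blast
  qed
qed

end
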